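(* Let $\Omega=\mathbb{R}^d$ with Borel $\sigma$-algebra and Lebesgue measure $m$. Let $\mathcal{F}$ be a convex set with $\mathcal{F}_0\subset\mathcal{F}\subset L_0^+$, and let $S$ be a composite score on $\mathcal{F}$ of the form $S(f,g)=\psi(\langle fU(g)\rangle,\langle V(g)\rangle)$ for all $f,g\in\mathcal{F}$, where $U,V,\psi$ satisfy conditions (a), (b), (c) of the context. Suppose that the divergence associated with $S$ is affine invariant. 1. If $U(z)=-\log z+c$ and $V(z)=z$ with a constant $c\in\mathbb{R}$, then $S$ is equivalent in probability with the Kullback–Leibler score $\langle -f\log g+g\rangle$. 2. If $\gamma>0$, $U(z)=z^\gamma+c$ and $V(z)=z^{1+\gamma}$ with a constant $c\in\mathbb{R}$, and $\mathcal{F}=L_{1+\gamma}^+$, then $S$ is equivalent in probability with the Hölder score with this $\gamma$ and some function $\phi$; that is, there is $\phi:\mathbb{R}_+\to\mathbb{R}$ with $\phi(1)=-1$ and $\phi(z)\ge-z^{1+\gamma}$ for all $z\ge0$ such that $S$ is equivalent in probability with $\phi\big(\langle fg^\gamma\rangle/\langle g^{1+\gamma}\rangle\big)\langle g^{1+\gamma}\rangle$.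
   Context: Notation: $\mathbb{R}_+=[0,\infty)$, $\mathbb{R}_+^\circ=(0,\infty)$; $\langle f\rangle=\int_\Omega f\,dm$; $L_0^+$ is the set of non-negative, non-zero measurable functions $\Omega\to\mathbb{R}$; $L_{1+\gamma}^+=\{f\in L_0^+:\langle f^{1+\gamma}\rangle<\infty\}$ (non-zero meaning not almost everywhere zero); $\mathcal{P}=\{p\in\mathcal{F}:\langle p\rangle=1\}$; $\psi_1,\psi_2$ are the partial derivatives of $\psi$. In case 1 the conventions $\log0=-\infty$ and $0\cdot\infty=0$ are used, so that integrability of $fU(g)$ for all $f,g\in\mathcal{F}$ forces $g>0$ almost everywhere on $\{f>0\}$. $\mathcal{F}_0$ is the set of $f\in L_0^+$ such that $\{\omega\in\Omega: f(\omega)>0\}=(0,1)^d$ and there exist $a,b\in\mathbb{R}$ with $0<a<f(\omega)<b$ for all $\omega\in(0,1)^d$. Composite score on a convex set $\mathcal{F}\subset L_0^+$: a function $S:\mathcal{F}\times\mathcal{F}\to\mathbb{R}$ such that (i) $S(f,g)=T(\int_\Omega S_0(\omega,g)f(\omega)dm(\omega),g)$ for some $S_0:\Omega\times\mathcal{F}\to\mathbb{R}$, $T:\mathbb{R}\times\mathcal{F}\to\mathbb{R}$, with $S_0(\cdot,g)f(\cdot)$ integrable for all $f,g\in\mathcal{F}$; (ii) $S(f,g)\ge S(f,f)$ for all $f,g\in\mathcal{F}$; (iii) for $p,q\in\mathcal{P}$, $S(p,q)=S(p,p)$ implies $p=q$ almost everywhere. The associated divergence is $D(f,g)=S(f,g)-S(f,f)$.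 Equivalence in probability: scores $S,\widetilde S$ on $\mathcal{F}$ are equivalent in probability if there is a strictly increasing function $\xi:\mathbb{R}\to\mathbb{R}$ with $\widetilde S(p,q)=\xi(S(p,q))$ for all $p,q\in\mathcal{P}$. Affine invariance: for an invertible matrix $\sigma\in\mathbb{R}^{d\times d}$ and $\mu\in\mathbb{R}^d$, put $p_{\sigma,\mu}(\omega)=|\det\sigma|\,p(\sigma\omega+\mu)$. $D$ is affine invariant if there is a function $h(\sigma,\mu)$ with values in $\mathbb{R}_+^\circ$ such that $h(\sigma,\mu)D(p_{\sigma,\mu},q_{\sigma,\mu})=D(p,q)$ for all $p,q\in\mathcal{P}$ and all such $(\sigma,\mu)$; here $D(p_{\sigma,\mu},q_{\sigma,\mu})$ is required to be well defined, by the formula defining $S$. Conditions on $U,V,\psi$: (a) $U,V$ are real-valued functions on $\mathbb{R}_+$ (except for the convention on $\log 0$ in case 1), $\psi$ is a real-valued function on a subset of $\mathbb{R}^2$, and $fU(g)$ and $V(g)$ are integrable for all $f,g\in\mathcal{F}$. (b) $U$ and $V$ are twice continuously differentiable on $\mathbb{R}_+^\circ$ and are not constant on $\mathbb{R}_+^\circ$; $\lim_{z\searrow0}V(z)=0=V(0)$, and the limit $\lim_{z\searrow0}V'(z)$ exists (in $\mathbb{R}$). (c) Let $D_{U,V}=\{(\langle fU(g)\rangle,\langle V(g)\rangle): f,g\in\mathcal{F}\}$ and $E_{U,V}=\{(\langle fU(f)\rangle,\langle V(f)\rangle): f\in\mathcal{F}\}$. Every point of $D_{U,V}$ has an open neighbourhood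 on which $\psi$ is twice continuously differentiable, and every point of $E_{U,V}$ has an open neighbourhood on which the gradient $(\psi_1,\psi_2)$ does not vanish.
   Formalization: In part 1 the equivalence is proved as S = ξ(KL score) with ξ strictly increasing on ℝ; the literal order, KL score = ξ(S) with ξ defined on all of ℝ, fails for S = exp of the KL score on F_0. Part 2 keeps the literal order. *)

theory Defs
  imports "HOL-Analysis.Analysis"
begin

section \<open>Function classes\<close>

definition L0_pos :: "(real ^ 'n \<Rightarrow> real) set" where
  "L0_pos = {f. f \<in> borel_measurable lborel \<and> (\<forall>\<omega>. 0 \<le> f \<omega>) \<and> \<not> (AE \<omega> in lborel. f \<omega> = 0)}"

definition L_pos :: "real \<Rightarrow> (real ^ 'n \<Rightarrow> real) set" where
  "L_pos \<gamma> = {f \<in> L0_pos. integrable lborel (\<lambda>\<omega>. f \<omega> powr (1 + \<gamma>))}"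

definition F0 :: "(real ^ 'n \<Rightarrow> real) set" where
  "F0 = {f \<in> L0_pos. {\<omega>. 0 < f \<omega>} = {\<omega>. \<forall>i. 0 < \<omega> $ i \<and> \<omega> $ i < 1} \<and>
           (\<exists>a b. 0 < a \<and> (\<forall>\<omega>. (\<forall>i. 0 < \<omega> $ i \<and> \<omega> $ i < 1) \<longrightarrow> a < f \<omega> \<and> f \<omega> < b))}"

text \<open>Function spaces are not an instance of the class of real vector spaces, so convexity of a set
  of functions is spelled out pointwise.\<close>

definition convex_funs :: "('a \<Rightarrow> real) set \<Rightarrow> bool" where
  "convex_funs F \<longleftrightarrow>
     (\<forall>f\<in>F. \<forall>g\<in>F. \<forall>t. 0 \<le> t \<and> t \<le> 1 \<longrightarrow> (\<lambda>\<omega>. (1 - t) * f \<omega> + t * g \<omega>) \<in> F)"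

definition prob_densities :: "(real ^ 'n \<Rightarrow> real) set \<Rightarrow> (real ^ 'n \<Rightarrow> real) set" where
  "prob_densities F = {p \<in> F. has_bochner_integral lborel p 1}"

section \<open>Integration of extended-real functions\<close>

text \<open>The function \<open>U\<close> below takes values in the extended reals, since \<open>- log 0\<close> is \<open>\<infinity>\<close>.
  The product on \<^typ>\<open>ereal\<close> satisfies \<open>0 * \<infinity> = 0\<close>.\<close>

definition ext_integrable :: "'a measure \<Rightarrow> ('a \<Rightarrow> ereal) \<Rightarrow> bool" where
  "ext_integrable M h \<longleftrightarrow> h \<in> borel_measurable M \<and> (\<integral>\<^sup>+ \<omega>. e2ennreal \<bar>h \<omega>\<bar> \<partial>M) < \<infinity>"

text \<open>An integrable \<open>h\<close> is finite almost everywhere, so \<^const>\<open>real_of_ereal\<close> alters its values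
  only on a null set.\<close>

definition ext_integral :: "'a measure \<Rightarrow> ('a \<Rightarrow> ereal) \<Rightarrow> real" where
  "ext_integral M h = (LINT \<omega>|M. real_of_ereal (h \<omega>))"

definition elog :: "real \<Rightarrow> ereal" where
  "elog z = (if z = 0 then - \<infinity> else ereal (ln z))"

section \<open>Scores\<close>

definition composite_score ::
  "(real ^ 'n \<Rightarrow> real) set \<Rightarrow> ((real ^ 'n \<Rightarrow> real) \<Rightarrow> (real ^ 'n \<Rightarrow> real) \<Rightarrow> real) \<Rightarrow> bool" where
  "composite_score F S \<longleftrightarrow>
     (\<exists>(S\<^sub>0 :: real ^ 'n \<Rightarrow> (real ^ 'n \<Rightarrow> real) \<Rightarrow> real) (T :: real \<Rightarrow> (real ^ 'n \<Rightarrow> real) \<Rightarrow> real).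
        \<forall>f\<in>F. \<forall>g\<in>F. integrable lborel (\<lambda>\<omega>. S\<^sub>0 \<omega> g * f \<omega>) \<and>
                    S f g = T (LINT \<omega>|lborel. S\<^sub>0 \<omega> g * f \<omega>) g) \<and>
     (\<forall>f\<in>F. \<forall>g\<in>F. S f f \<le> S f g) \<and>
     (\<forall>p\<in>prob_densities F. \<forall>q\<in>prob_densities F.
        S p q = S p p \<longrightarrow> (AE \<omega> in lborel. p \<omega> = q \<omega>))"

definition divergence :: "('f \<Rightarrow> 'f \<Rightarrow> real) \<Rightarrow> 'f \<Rightarrow> 'f \<Rightarrow> real" where
  "divergence S f g = S f g - S f f"

text \<open>\<open>equivalent_in_probability F S S'\<close> says that \<open>S'\<close> is a strictly increasing transform of \<open>S\<close>.
  As \<open>\<xi>\<close> is defined on the whole real line but need not be onto, the relation is not symmetric: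
  \<open>exp \<circ> S\<close> is a transform of \<open>S\<close>, but \<open>S\<close> is not a transform of \<open>exp \<circ> S\<close> if \<open>S\<close> is unbounded
  from below on probability densities.\<close>

definition equivalent_in_probability ::
  "(real ^ 'n \<Rightarrow> real) set \<Rightarrow> ((real ^ 'n \<Rightarrow> real) \<Rightarrow> (real ^ 'n \<Rightarrow> real) \<Rightarrow> real) \<Rightarrow>
     ((real ^ 'n \<Rightarrow> real) \<Rightarrow> (real ^ 'n \<Rightarrow> real) \<Rightarrow> real) \<Rightarrow> bool" where
  "equivalent_in_probability F S S' \<longleftrightarrow>
     (\<exists>\<xi> :: real \<Rightarrow> real. strict_mono \<xi> \<and>
        (\<forall>p\<in>prob_densities F. \<forall>q\<in>prob_densities F. S' p q = \<xi> (S p q)))"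

definition KL_score :: "(real ^ 'n \<Rightarrow> real) \<Rightarrow> (real ^ 'n \<Rightarrow> real) \<Rightarrow> real" where
  "KL_score f g = ext_integral lborel (\<lambda>\<omega>. - (ereal (f \<omega>) * elog (g \<omega>)) + ereal (g \<omega>))"

definition Holder_score ::
  "real \<Rightarrow> (real \<Rightarrow> real) \<Rightarrow> (real ^ 'n \<Rightarrow> real) \<Rightarrow> (real ^ 'n \<Rightarrow> real) \<Rightarrow> real" where
  "Holder_score \<gamma> \<phi> f g =
     \<phi> ((LINT \<omega>|lborel. f \<omega> * g \<omega> powr \<gamma>) / (LINT \<omega>|lborel. g \<omega> powr (1 + \<gamma>))) *
     (LINT \<omega>|lborel. g \<omega> powr (1 + \<gamma>))"

section \<open>Scores given by \<open>U\<close>, \<open>V\<close> and \<open>\<psi>\<close>\<close>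

definition pair_UV ::
  "(real \<Rightarrow> ereal) \<Rightarrow> (real \<Rightarrow> real) \<Rightarrow> (real ^ 'n \<Rightarrow> real) \<Rightarrow> (real ^ 'n \<Rightarrow> real) \<Rightarrow> real \<times> real" where
  "pair_UV U V f g =
     (ext_integral lborel (\<lambda>\<omega>. ereal (f \<omega>) * U (g \<omega>)), LINT \<omega>|lborel. V (g \<omega>))"

definition pair_UV_exists ::
  "(real \<Rightarrow> ereal) \<Rightarrow> (real \<Rightarrow> real) \<Rightarrow> (real ^ 'n \<Rightarrow> real) \<Rightarrow> (real ^ 'n \<Rightarrow> real) \<Rightarrow> bool" where
  "pair_UV_exists U V f g \<longleftrightarrow>
     ext_integrable lborel (\<lambda>\<omega>. ereal (f \<omega>) * U (g \<omega>)) \<and> integrable lborel (\<lambda>\<omega>. V (g \<omega>))"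

definition twice_continuously_differentiable_on ::
  "'a::real_normed_vector set \<Rightarrow> ('a \<Rightarrow> 'b::real_normed_vector) \<Rightarrow> bool" where
  "twice_continuously_differentiable_on N f \<longleftrightarrow>
     (\<exists>(f' :: 'a \<Rightarrow> 'a \<Rightarrow>\<^sub>L 'b) (f'' :: 'a \<Rightarrow> 'a \<Rightarrow>\<^sub>L ('a \<Rightarrow>\<^sub>L 'b)).
        (\<forall>x\<in>N. (f has_derivative blinfun_apply (f' x)) (at x)) \<and>
        (\<forall>x\<in>N. (f' has_derivative blinfun_apply (f'' x)) (at x)) \<and>
        continuous_on N f'')"

definition condition_a ::
  "(real ^ 'n \<Rightarrow> real) set \<Rightarrow> (real \<Rightarrow> ereal) \<Rightarrow> (real \<Rightarrow> real) \<Rightarrow> bool" where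
  "condition_a F U V \<longleftrightarrow>
     (\<forall>z\<ge>0. \<bar>U z\<bar> \<noteq> \<infinity> \<or> z = 0 \<and> U z = \<infinity>) \<and>
     (\<forall>f\<in>F. \<forall>g\<in>F. pair_UV_exists U V f g)"

definition condition_b :: "(real \<Rightarrow> ereal) \<Rightarrow> (real \<Rightarrow> real) \<Rightarrow> bool" where
  "condition_b U V \<longleftrightarrow>
     twice_continuously_differentiable_on {0<..} (\<lambda>z. real_of_ereal (U z)) \<and>
     twice_continuously_differentiable_on {0<..} V \<and>
     \<not> U constant_on {0<..} \<and> \<not> V constant_on {0<..} \<and>
     (V \<longlongrightarrow> 0) (at_right 0) \<and> V 0 = 0 \<and>
     (\<exists>L. (deriv V \<longlongrightarrow> L) (at_right 0))"

text \<open>The set \<open>\<Psi>\<close> is the domain of \<open>\<psi>\<close>; the values of \<open>\<psi>\<close> outside \<open>\<Psi>\<close> are irrelevant.\<close>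

definition condition_c ::
  "(real ^ 'n \<Rightarrow> real) set \<Rightarrow> (real \<Rightarrow> ereal) \<Rightarrow> (real \<Rightarrow> real) \<Rightarrow>
     (real \<times> real) set \<Rightarrow> (real \<times> real \<Rightarrow> real) \<Rightarrow> bool" where
  "condition_c F U V \<Psi> \<psi> \<longleftrightarrow>
     (\<forall>f\<in>F. \<forall>g\<in>F. \<exists>N. open N \<and> pair_UV U V f g \<in> N \<and> N \<subseteq> \<Psi> \<and>
        twice_continuously_differentiable_on N \<psi>) \<and>
     (\<forall>f\<in>F. \<exists>N. open N \<and> pair_UV U V f f \<in> N \<and> N \<subseteq> \<Psi> \<and>
        (\<forall>x\<in>N. \<exists>D. GDERIV \<psi> x :> D \<and> D \<noteq> 0))"

section \<open>Affine invariance\<close>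

definition affine_density ::
  "real ^ 'n ^ 'n \<Rightarrow> real ^ 'n \<Rightarrow> (real ^ 'n \<Rightarrow> real) \<Rightarrow> (real ^ 'n \<Rightarrow> real)" where
  "affine_density \<sigma> \<mu> p = (\<lambda>\<omega>. \<bar>det \<sigma>\<bar> * p (\<sigma> *v \<omega> + \<mu>))"

text \<open>The transformed densities need not belong to \<open>F\<close>, so the score is evaluated at them through
  its defining formula, all of whose ingredients are required to make sense.\<close>

definition score_formula ::
  "(real \<Rightarrow> ereal) \<Rightarrow> (real \<Rightarrow> real) \<Rightarrow> (real \<times> real \<Rightarrow> real) \<Rightarrow>
     (real ^ 'n \<Rightarrow> real) \<Rightarrow> (real ^ 'n \<Rightarrow> real) \<Rightarrow> real" where
  "score_formula U V \<psi> f g = \<psi> (pair_UV U V f g)"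

definition score_well_defined ::
  "(real \<Rightarrow> ereal) \<Rightarrow> (real \<Rightarrow> real) \<Rightarrow> (real \<times> real) set \<Rightarrow>
     (real ^ 'n \<Rightarrow> real) \<Rightarrow> (real ^ 'n \<Rightarrow> real) \<Rightarrow> bool" where
  "score_well_defined U V \<Psi> f g \<longleftrightarrow> pair_UV_exists U V f g \<and> pair_UV U V f g \<in> \<Psi>"

definition affine_invariant ::
  "(real ^ 'n \<Rightarrow> real) set \<Rightarrow> (real \<Rightarrow> ereal) \<Rightarrow> (real \<Rightarrow> real) \<Rightarrow>
     (real \<times> real) set \<Rightarrow> (real \<times> real \<Rightarrow> real) \<Rightarrow> bool" where
  "affine_invariant F U V \<Psi> \<psi> \<longleftrightarrow>
     (\<exists>h :: real ^ 'n ^ 'n \<Rightarrow> real ^ 'n \<Rightarrow> real. \<forall>\<sigma> \<mu>. invertible \<sigma> \<longrightarrow>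
        0 < h \<sigma> \<mu> \<and>
        (\<forall>p\<in>prob_densities F. \<forall>q\<in>prob_densities F.
           score_well_defined U V \<Psi> (affine_density \<sigma> \<mu> p) (affine_density \<sigma> \<mu> q) \<and>
           score_well_defined U V \<Psi> (affine_density \<sigma> \<mu> p) (affine_density \<sigma> \<mu> p) \<and>
           h \<sigma> \<mu> * divergence (score_formula U V \<psi>) (affine_density \<sigma> \<mu> p) (affine_density \<sigma> \<mu> q)
             = divergence (score_formula U V \<psi>) p q))"

end

theory Submission
  imports Defs
begin

text \<open>
  Both parts test the two hypotheses, propriety and affine invariance, on densities with two
  values. Propriety supplies strict inequalities, dilations carry them to every scale, and the result
  determines \<open>\<psi>\<close> up to an increasing transform at the values that probability densities attain.

  In the logarithmic case the pair of integrals at probability densities is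
  \<open>(KL_score p q - 1 + c, 1)\<close>, so \<open>S\<close> is a function \<open>s\<close> of the Kullback--Leibler score, and \<open>s\<close> has
  to be increasing on the whole real line. If \<open>p\<close> is uniform on the unit cube and \<open>q\<close> takes two
  values there, then \<open>KL_score p q\<close> exceeds \<open>KL_score p p\<close> by an arbitrary \<open>x > 0\<close>, and propriety
  gives one strict inequality between two values of \<open>s\<close> at distance \<open>x\<close>. A dilation translates
  the score by an arbitrary real number and multiplies the divergence by a positive factor, so
  this inequality holds between any two points at distance \<open>x\<close>
  (\<open>log_score_increasing_in_KL\<close>).

  In the power case write \<open>X p q = \<langle>p q\<^sup>\<gamma>\<rangle>\<close>, \<open>Y q = \<langle>q\<^sup>1\<^sup>+\<^sup>\<gamma>\<rangle>\<close>, \<open>\<Phi> x y = \<psi> (x + c, y)\<close> and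
  \<open>u w = \<Phi> w w\<close>, so that \<open>S p q = \<Phi> (X p q) (Y q)\<close> and \<open>S p p = u (Y p)\<close>. A dilation multiplies
  \<open>X\<close> and \<open>Y\<close> by a common factor \<open>t\<close>. Uniform densities on nested sets show that \<open>u\<close> is strictly
  decreasing, and densities with disjoint supports show that \<open>u\<close> is bounded above by \<open>\<Phi> 0 1\<close>. Let \<open>A\<close> be
  its supremum. Invariance gives \<open>A - u (t w) = k(t) (A - u w)\<close>, a multiplicative Cauchy equation
  with a monotone solution, so \<open>u w = A - B w\<^sup>\<kappa>\<close> for some \<open>B, \<kappa> > 0\<close>; the bound on \<open>u\<close> is what
  excludes logarithms and negative powers. Moreover \<open>\<Phi> - A\<close> is homogeneous of degree \<open>\<kappa>\<close>, so that the
  increasing function \<open>\<xi>\<close> taking \<open>v\<close> to the signed \<open>\<kappa>\<close>-th root of \<open>(v - A) / B\<close> turns \<open>\<Phi>\<close> into a function of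
  degree one, \<open>\<phi> (x / y) y\<close> with \<open>\<phi> z = \<xi> (\<Phi> z 1)\<close>. On the diagonal it equals \<open>- w\<close>, whence
  \<open>\<phi> 1 = - 1\<close>, and propriety says \<open>\<phi> (X p q / Y q) \<ge> - Y p / Y q\<close>. The lower bound for \<open>\<phi>\<close>
  follows from pairs of densities that almost attain equality in Hoelder's inequality
  \<open>(X p q / Y q)\<^sup>1\<^sup>+\<^sup>\<gamma> \<le> Y p / Y q\<close> (\<open>sharp_pair_exists\<close>).
\<close>


section \<open>Dilations of Lebesgue measure\<close>

lemma LINT_dilation:
  fixes f :: "real ^ 'n \<Rightarrow> real"
  assumes [measurable]: "f \<in> borel_measurable lborel" and r: "r > 0"
  shows "(LINT \<omega>|lborel. f (r *\<^sub>R \<omega>)) = (LINT \<omega>|lborel. f \<omega>) / r ^ CARD('n)"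
proof -
  have "(LINT \<omega>|lborel. f \<omega>) =
      (LINT \<omega>|density (distr lborel borel (\<lambda>x. 0 + r *\<^sub>R x)) (\<lambda>_. \<bar>r\<bar>^DIM(real ^ 'n)). f \<omega>)"
    by (subst lborel_affine[of r "0 :: real ^ 'n", symmetric]) (use r in simp_all)
  also have "\<dots> = r ^ CARD('n) * (LINT \<omega>|lborel. f (r *\<^sub>R \<omega>))"
    using r by (simp add: integral_density integral_distr ennreal_power)
  finally show ?thesis using r by (simp add: field_simps)
qed

text \<open>The determinant is the only feature of an affine map that matters for integrals, so
  multiples of the identity already give every scale.\<close>

lemma dilation_with_determinant:
  fixes R :: real
  assumes "R > 0"
  obtains \<sigma> :: "real ^ 'n ^ 'n" where "invertible \<sigma>" "\<bar>det \<sigma>\<bar> = R"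
    "\<And>f :: real ^ 'n \<Rightarrow> real. f \<in> borel_measurable lborel \<Longrightarrow>
        (LINT \<omega>|lborel. f (\<sigma> *v \<omega>)) = (LINT \<omega>|lborel. f \<omega>) / R"
proof -
  define r where "r = root CARD('n) R"
  have r: "r > 0" "r ^ CARD('n) = R"
    using assms by (auto simp: r_def)
  have d: "det (mat r :: real ^ 'n ^ 'n) = R"
    using det_matrix_scaleR[of r, where 'n='n] r(2) by (simp add: matrix_scaleR)
  have m: "mat r *v \<omega> = r *\<^sub>R \<omega>" for \<omega> :: "real ^ 'n"
    by (simp add: vec_eq_iff matrix_vector_mult_def mat_def if_distrib[of "\<lambda>x. x * _"] cong: if_cong)
  show thesis
    by (rule that[of "mat r"]) (use d r assms LINT_dilation[where 'n='n, OF _ r(1)] in \<open>auto simp: invertible_det_nz m\<close>)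
qed
section \<open>Two-step densities\<close>

text \<open>Stretching only the coordinate \<open>k\<close> makes the measure linear in the length, so that boxes can be
  cut along \<open>k\<close> into pieces of prescribed measure.\<close>

lemma emeasure_slab:
  fixes k :: "'n::finite" and s t :: real
  assumes "s \<le> t"
  shows "emeasure lborel (box (\<chi> i. if i = k then s else 0) (\<chi> i. if i = k then t else (1 :: real))) = ennreal (t - s)"
proof -
  let ?l = "\<chi> i::'n. if i = k then s else 0" and ?u = "\<chi> i::'n. if i = k then t else (1 :: real)"
  have ne: "?l \<in> cbox ?l ?u"
    using assms by (auto simp: mem_box_cart)
  have "emeasure lborel (box ?l ?u) = ennreal (measure lborel (box ?l ?u))"
    using emeasure_lborel_box_finite[of ?l ?u] by (intro emeasure_eq_ennreal_measure) auto
  also have "measure lborel (box ?l ?u) = measure lborel (cbox ?l ?u)"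
    by (simp add: measure_lborel_box_eq measure_lborel_cbox_eq)
  also have "\<dots> = (\<Prod>i\<in>UNIV. ?u $ i - ?l $ i)"
    using ne content_cbox_cart[of ?l ?u] by (auto simp:)
  also have "\<dots> = (\<Prod>i\<in>UNIV. if i = k then t - s else 1)"
    by (intro prod.cong) auto
  finally show ?thesis by simp
qed

text \<open>The last conclusion lets the blocks be pieces of the open unit cube, which is the common
  support of the functions in \<^const>\<open>F0\<close>.\<close>

lemma disjoint_blocks_exist:
  fixes \<alpha> \<beta> :: real
  assumes "\<alpha> > 0" "\<beta> > 0"
  obtains A B :: "(real ^ 'n) set" where
    "A \<in> sets lborel" "B \<in> sets lborel" "A \<inter> B = {}"
    "emeasure lborel A = ennreal \<alpha>" "emeasure lborel B = ennreal \<beta>"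
    "\<alpha> + \<beta> = 1 \<Longrightarrow> A \<union> B = {\<omega>. \<forall>i. 0 < \<omega> $ i \<and> \<omega> $ i < 1}"
proof -
  obtain k :: 'n where True by blast
  (* The trivial case distinction exhibits T as the slab from 0 to \<alpha> + \<beta>. *)
  define T where "T = box (\<chi> i::'n. if i = k then 0 else 0) (\<chi> i. if i = k then \<alpha> + \<beta> else (1 :: real))"
  define B where "B = box (\<chi> i::'n. if i = k then \<alpha> else 0) (\<chi> i. if i = k then \<alpha> + \<beta> else (1 :: real))"
  have T: "emeasure lborel T = ennreal (\<alpha> + \<beta>)"
    unfolding T_def by (subst emeasure_slab) (use assms in auto)
  have B: "emeasure lborel B = ennreal \<beta>"
    unfolding B_def by (subst emeasure_slab) (use assms in auto)
  have sub: "B \<subseteq> T"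
  proof
    fix x assume "x \<in> B"
    then have "(if i = k then \<alpha> else 0) < x $ i \<and> x $ i < (if i = k then \<alpha> + \<beta> else 1)" for i
      by (simp add: B_def mem_box_cart)
    then have "0 < x $ i \<and> x $ i < (if i = k then \<alpha> + \<beta> else 1)" for i
      using assms by (smt (verit, best))
    then show "x \<in> T"
      by (simp add: T_def mem_box_cart)
  qed
  have "emeasure lborel (T - B) = ennreal (\<alpha> + \<beta>) - ennreal \<beta>"
    using sub T B by (subst emeasure_Diff) (auto simp: B_def T_def)
  then have D: "emeasure lborel (T - B) = ennreal \<alpha>"
    using assms by (simp add: ennreal_minus)
  show thesis
  proof (rule that[of "T - B" B])
    assume "\<alpha> + \<beta> = 1"
    then have "T = {\<omega>. \<forall>i. 0 < \<omega> $ i \<and> \<omega> $ i < 1}"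
      by (auto simp: T_def mem_box_cart split: if_splits)
    then show "T - B \<union> B = {\<omega>. \<forall>i. 0 < \<omega> $ i \<and> \<omega> $ i < 1}"
      using sub by blast
  qed (use D B in \<open>auto simp: T_def B_def\<close>)
qed

definition two_step :: "'a set \<Rightarrow> 'a set \<Rightarrow> real \<Rightarrow> real \<Rightarrow> 'a \<Rightarrow> real" where
  "two_step A B a b \<omega> = (if \<omega> \<in> A then a else if \<omega> \<in> B then b else 0)"

locale two_blocks =
  fixes A B :: "(real ^ 'n) set" and \<alpha> \<beta> :: real
  assumes sets_A [measurable]: "A \<in> sets borel" and sets_B [measurable]: "B \<in> sets borel"
    and disj: "A \<inter> B = {}" and pos: "\<alpha> > 0" "\<beta> > 0"
    and measure_A: "emeasure lborel A = ennreal \<alpha>" and measure_B: "emeasure lborel B = ennreal \<beta>"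
begin

lemma has_integral_two_step:
  "has_bochner_integral lborel (two_step A B a b) (a * \<alpha> + b * \<beta>)"
proof -
  have eq: "two_step A B a b = (\<lambda>\<omega>. a * indicator A \<omega> + b * indicator B \<omega>)"
    using disj by (auto simp: two_step_def indicator_def fun_eq_iff)
  have "has_bochner_integral lborel (\<lambda>\<omega>. a * indicator A \<omega> + b * indicator B \<omega>)
      (a * measure lborel A + b * measure lborel B)"
    by (intro has_bochner_integral_add has_bochner_integral_mult_right has_bochner_integral_real_indicator)
       (use measure_A measure_B in auto)
  then show ?thesis
    using pos measure_A measure_B by (simp add: eq measure_def)
qed

lemma borel_measurable_two_step [measurable]: "two_step A B a b \<in> borel_measurable borel"
  using has_integral_two_step[of a b] borel_measurable_integrable by (fastforce simp: has_bochner_integral_iff)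

lemma integrable_two_step: "integrable lborel (two_step A B a b)"
  using has_integral_two_step[of a b] by (simp add: has_bochner_integral_iff)

lemma integral_two_step: "(LINT \<omega>|lborel. two_step A B a b \<omega>) = a * \<alpha> + b * \<beta>"
  using has_integral_two_step by (rule has_bochner_integral_integral_eq)

lemma in_L0_pos:
  assumes "a \<ge> 0" "b \<ge> 0" "a * \<alpha> + b * \<beta> = 1"
  shows "two_step A B a b \<in> L0_pos"
proof -
  have "\<not> (AE \<omega> in lborel. two_step A B a b \<omega> = 0)"
  proof
    assume "AE \<omega> in lborel. two_step A B a b \<omega> = 0"
    then have "(LINT \<omega>|lborel. two_step A B a b \<omega>) = 0"
      by (rule integral_eq_zero_AE)
    with assms show False by (simp add: integral_two_step)
  qed
  then show ?thesis
    using assms by (auto simp: L0_pos_def two_step_def[of A B a b])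
qed

lemma in_prob_densities:
  assumes "two_step A B a b \<in> F" "a * \<alpha> + b * \<beta> = 1"
  shows "two_step A B a b \<in> prob_densities F"
  using assms has_integral_two_step[of a b] by (simp add: prob_densities_def)

lemma in_F0:
  assumes "A \<union> B = {\<omega>. \<forall>i. 0 < \<omega> $ i \<and> \<omega> $ i < 1}" "a > 0" "b > 0" "a * \<alpha> + b * \<beta> = 1"
  shows "two_step A B a b \<in> F0"
proof -
  have *: "\<omega> \<in> A \<or> \<omega> \<in> B \<longleftrightarrow> (\<forall>i. 0 < \<omega> $ i \<and> \<omega> $ i < 1)" for \<omega>
    using assms(1) by blast
  have "{\<omega>. 0 < two_step A B a b \<omega>} = {\<omega>. \<forall>i. 0 < \<omega> $ i \<and> \<omega> $ i < 1}"
    using assms(2,3) unfolding *[symmetric] by (auto simp: two_step_def)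
  moreover have "\<exists>l u. 0 < l \<and> (\<forall>\<omega>. (\<forall>i. 0 < \<omega> $ i \<and> \<omega> $ i < 1) \<longrightarrow>
      l < two_step A B a b \<omega> \<and> two_step A B a b \<omega> < u)"
    using assms(2,3) unfolding *[symmetric]
    by (intro exI[of _ "min a b / 2"] exI[of _ "max a b + 1"]) (auto simp: two_step_def)
  ultimately show ?thesis
    using in_L0_pos[of a b] assms by (simp add: F0_def)
qed

lemma in_L_pos:
  assumes "a \<ge> 0" "b \<ge> 0" "a * \<alpha> + b * \<beta> = 1"
  shows "two_step A B a b \<in> L_pos \<gamma>"
proof -
  have "(\<lambda>\<omega>. two_step A B a b \<omega> powr (1 + \<gamma>)) = two_step A B (a powr (1 + \<gamma>)) (b powr (1 + \<gamma>))"
    by (auto simp: two_step_def)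
  then show ?thesis
    using in_L0_pos[OF assms] integrable_two_step by (simp add: L_pos_def)
qed

lemma not_AE_eq:
  assumes "b \<noteq> b'"
  shows "\<not> (AE \<omega> in lborel. two_step A B a b \<omega> = two_step A B a' b' \<omega>)"
proof
  assume "AE \<omega> in lborel. two_step A B a b \<omega> = two_step A B a' b' \<omega>"
  then have "AE \<omega> in lborel. two_step A B \<bar>a - a'\<bar> \<bar>b - b'\<bar> \<omega> = 0"
    by eventually_elim (auto simp: two_step_def split: if_splits)
  then have "(LINT \<omega>|lborel. two_step A B \<bar>a - a'\<bar> \<bar>b - b'\<bar> \<omega>) = 0"
    by (rule integral_eq_zero_AE)
  then have "\<bar>a - a'\<bar> * \<alpha> + \<bar>b - b'\<bar> * \<beta> = 0"
    by (simp add: integral_two_step)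
  moreover have "\<bar>a - a'\<bar> * \<alpha> \<ge> 0" "\<bar>b - b'\<bar> * \<beta> > 0"
    using pos assms by auto
  ultimately show False by simp
qed

text \<open>Outside both blocks the integrand is \<open>0 * U 0\<close>, which vanishes even if \<open>U 0 = \<infinity>\<close>; hence the
  integral has one term for each block.\<close>

lemma pair_UV_dilated:
  assumes dil: "\<And>f :: real ^ 'n \<Rightarrow> real. f \<in> borel_measurable lborel \<Longrightarrow>
        (LINT \<omega>|lborel. f (\<sigma> *v \<omega>)) = (LINT \<omega>|lborel. f \<omega>) / R"
    and R: "\<bar>det \<sigma>\<bar> = R" and "V 0 = 0"
  shows "pair_UV U V (affine_density \<sigma> 0 (two_step A B a b)) (affine_density \<sigma> 0 (two_step A B a' b')) =
     ((real_of_ereal (ereal (R * a) * U (R * a')) * \<alpha> + real_of_ereal (ereal (R * b) * U (R * b')) * \<beta>) / R,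
      (V (R * a') * \<alpha> + V (R * b') * \<beta>) / R)"
proof -
  have "(\<lambda>\<omega>. real_of_ereal (ereal (affine_density \<sigma> 0 (two_step A B a b) \<omega>) * U (affine_density \<sigma> 0 (two_step A B a' b') \<omega>)))
     = (\<lambda>\<omega>. two_step A B (real_of_ereal (ereal (R * a) * U (R * a'))) (real_of_ereal (ereal (R * b) * U (R * b'))) (\<sigma> *v \<omega>))"
    by (auto simp: two_step_def affine_density_def R zero_ereal_def[symmetric])
  moreover have "(\<lambda>\<omega>. V (affine_density \<sigma> 0 (two_step A B a' b') \<omega>))
     = (\<lambda>\<omega>. two_step A B (V (R * a')) (V (R * b')) (\<sigma> *v \<omega>))"
    using \<open>V 0 = 0\<close> by (auto simp: two_step_def affine_density_def R)
  ultimately show ?thesis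
    by (simp add: pair_UV_def ext_integral_def dil integral_two_step)
qed

lemma power_integrals:
  shows "(LINT \<omega>|lborel. two_step A B a b \<omega> * two_step A B a' b' \<omega> powr \<gamma>)
      = a * a' powr \<gamma> * \<alpha> + b * b' powr \<gamma> * \<beta>"
    and "(LINT \<omega>|lborel. two_step A B a b \<omega> powr (1 + \<gamma>)) = a powr (1 + \<gamma>) * \<alpha> + b powr (1 + \<gamma>) * \<beta>"
proof -
  have "(\<lambda>\<omega>. two_step A B a b \<omega> * two_step A B a' b' \<omega> powr \<gamma>) = two_step A B (a * a' powr \<gamma>) (b * b' powr \<gamma>)"
    "(\<lambda>\<omega>. two_step A B a b \<omega> powr (1 + \<gamma>)) = two_step A B (a powr (1 + \<gamma>)) (b powr (1 + \<gamma>))"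
    by (auto simp: two_step_def)
  then show "(LINT \<omega>|lborel. two_step A B a b \<omega> * two_step A B a' b' \<omega> powr \<gamma>)
      = a * a' powr \<gamma> * \<alpha> + b * b' powr \<gamma> * \<beta>"
    "(LINT \<omega>|lborel. two_step A B a b \<omega> powr (1 + \<gamma>)) = a powr (1 + \<gamma>) * \<alpha> + b powr (1 + \<gamma>) * \<beta>"
    by (simp_all add: integral_two_step)
qed

end

section \<open>Integrability and strict propriety\<close>

lemma ext_integrable_AE_finite:
  assumes "ext_integrable M h"
  shows "AE x in M. \<bar>h x\<bar> \<noteq> \<infinity>"
proof -
  have [measurable]: "h \<in> borel_measurable M" and "(\<integral>\<^sup>+ x. e2ennreal \<bar>h x\<bar> \<partial>M) \<noteq> \<infinity>"
    using assms by (auto simp: ext_integrable_def)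
  then have "AE x in M. e2ennreal \<bar>h x\<bar> \<noteq> \<infinity>"
    by (intro nn_integral_PInf_AE) auto
  then show ?thesis
    by eventually_elim auto
qed

text \<open>At an infinite value the function \<^const>\<open>real_of_ereal\<close> returns \<open>0\<close>, so it never increases
  the absolute value.\<close>

lemma ext_integrable_integrable:
  assumes "ext_integrable M h"
  shows "integrable M (\<lambda>x. real_of_ereal (h x))"
proof (rule integrableI_bounded)
  have [measurable]: "h \<in> borel_measurable M" and fin: "(\<integral>\<^sup>+ x. e2ennreal \<bar>h x\<bar> \<partial>M) < \<infinity>"
    using assms by (auto simp: ext_integrable_def)
  show "(\<lambda>x. real_of_ereal (h x)) \<in> borel_measurable M"
    by measurable
  have "ennreal (norm (real_of_ereal y)) \<le> e2ennreal \<bar>y\<bar>" for y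
    by (cases y) (auto simp: e2ennreal_ereal)
  then have "(\<integral>\<^sup>+ x. ennreal (norm (real_of_ereal (h x))) \<partial>M) \<le> (\<integral>\<^sup>+ x. e2ennreal \<bar>h x\<bar> \<partial>M)"
    by (intro nn_integral_mono)
  with fin show "(\<integral>\<^sup>+ x. ennreal (norm (real_of_ereal (h x))) \<partial>M) < \<infinity>"
    by (rule le_less_trans[rotated])
qed

lemma prob_densitiesD:
  assumes "p \<in> prob_densities F" "F \<subseteq> L0_pos"
  shows "p \<in> F" "p \<in> borel_measurable borel" "\<And>\<omega>. 0 \<le> p \<omega>" "integrable lborel p"
    "(LINT \<omega>|lborel. p \<omega>) = 1" "\<not> (AE \<omega> in lborel. p \<omega> = 0)"
  using assms has_bochner_integral_iff[of lborel p 1] by (auto simp: prob_densities_def L0_pos_def)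

lemma proper_strict:
  assumes "composite_score F S" "p \<in> prob_densities F" "q \<in> prob_densities F"
    and "\<not> (AE \<omega> in lborel. p \<omega> = q \<omega>)"
  shows "S p p < S p q"
proof -
  have "S p p \<le> S p q" "S p q \<noteq> S p p"
    using assms by (auto simp: composite_score_def prob_densities_def)
  then show ?thesis by simp
qed

section \<open>The logarithmic score\<close>

text \<open>The two integrands agree only where \<open>p * U q\<close> is finite: if \<open>q\<close> vanishes where \<open>p\<close> does not,
  both are infinite and \<^const>\<open>real_of_ereal\<close> loses the terms that distinguish them. Integrability
  makes this a null set.\<close>

lemma pair_UV_log:
  assumes F: "F \<subseteq> L0_pos" and p: "p \<in> prob_densities F" and q: "q \<in> prob_densities F"
    and U: "\<forall>z\<ge>0. U z = - elog z + ereal c" and V: "\<forall>z\<ge>0. V z = z"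
    and ex: "pair_UV_exists U V p q"
  shows "pair_UV U V p q = (KL_score p q - 1 + c, 1)"
proof -
  note p' = prob_densitiesD[OF p F] and q' = prob_densitiesD[OF q F]
  have ext: "ext_integrable lborel (\<lambda>\<omega>. ereal (p \<omega>) * U (q \<omega>))"
    using ex by (simp add: pair_UV_exists_def)
  note int = ext_integrable_integrable[OF ext]
  have borel_KL: "(\<lambda>\<omega>. real_of_ereal (- (ereal (p \<omega>) * elog (q \<omega>)) + ereal (q \<omega>))) \<in> borel_measurable lborel"
    using p'(2) q'(2) unfolding elog_def by measurable
  have "AE \<omega> in lborel. real_of_ereal (- (ereal (p \<omega>) * elog (q \<omega>)) + ereal (q \<omega>))
      = real_of_ereal (ereal (p \<omega>) * U (q \<omega>)) - c * p \<omega> + q \<omega>"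
    using ext_integrable_AE_finite[OF ext]
  proof eventually_elim
    case (elim \<omega>)
    consider "p \<omega> = 0" | "p \<omega> > 0" "q \<omega> > 0" | "p \<omega> > 0" "q \<omega> = 0"
      using p'(3)[of \<omega>] q'(3)[of \<omega>] by fastforce
    then show ?case
      using elim U q'(3)[of \<omega>] by cases (auto simp: elog_def zero_ereal_def[symmetric] algebra_simps)
  qed
  then have "KL_score p q = (LINT \<omega>|lborel. real_of_ereal (ereal (p \<omega>) * U (q \<omega>)) - c * p \<omega> + q \<omega>)"
    unfolding KL_score_def ext_integral_def
    by (rule integral_cong_AE[rotated 2]) (use borel_KL int p' q' in auto)
  also have "\<dots> = fst (pair_UV U V p q) - c + 1"
    using int p' q' by (simp add: pair_UV_def ext_integral_def)
  finally have "fst (pair_UV U V p q) = KL_score p q - 1 + c" by simp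
  moreover have "snd (pair_UV U V p q) = 1"
    using V q' by (simp add: pair_UV_def)
  ultimately show ?thesis by (simp add: prod_eq_iff)
qed


text \<open>A density \<open>p\<close> that is uniform on the unit cube, with \<open>q = 1 \<plusminus> \<delta>\<close> on its two halves, has
  \<open>\<langle>p log q\<rangle> = log (1 - \<delta>\<^sup>2) / 2\<close>, which takes every negative value. A dilation with determinant \<open>R\<close>
  subtracts \<open>log R\<close> from both Kullback--Leibler scores, so a single family of pairs reaches
  all pairs of points on the real line.\<close>

lemma log_score_increasing_in_KL:
  fixes F :: "(real ^ 'n \<Rightarrow> real) set"
  assumes F: "F0 \<subseteq> F" "F \<subseteq> L0_pos" and a: "condition_a F U V"
    and comp: "composite_score F S"
    and S: "\<forall>f\<in>F. \<forall>g\<in>F. S f g = score_formula U V \<psi> f g"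
    and aff: "affine_invariant F U V \<Psi> \<psi>"
    and U: "\<forall>z\<ge>0. U z = - elog z + ereal c" and V: "\<forall>z\<ge>0. V z = z"
  shows "equivalent_in_probability F KL_score S"
proof -
  let ?P = "prob_densities F"
  obtain h where h: "\<And>\<sigma> \<mu> p q. invertible \<sigma> \<Longrightarrow> p \<in> ?P \<Longrightarrow> q \<in> ?P \<Longrightarrow> 0 < h \<sigma> \<mu> \<and>
      h \<sigma> \<mu> * divergence (score_formula U V \<psi>) (affine_density \<sigma> \<mu> p) (affine_density \<sigma> \<mu> q)
       = divergence (score_formula U V \<psi>) p q"
    using aff unfolding affine_invariant_def by blast
  obtain A B :: "(real ^ 'n) set" where AB: "A \<in> sets lborel" "B \<in> sets lborel" "A \<inter> B = {}"
    "emeasure lborel A = ennreal (1/2)" "emeasure lborel B = ennreal (1/2)"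
    "A \<union> B = {\<omega>. \<forall>i. 0 < \<omega> $ i \<and> \<omega> $ i < 1}"
    by (rule disjoint_blocks_exist[of "1/2" "1/2"]) auto
  interpret two_blocks A B "1/2" "1/2"
    by unfold_locales (use AB in auto)
  have P: "two_step A B x y \<in> ?P" if "x > 0" "y > 0" "x + y = 2" for x y
    using in_F0[OF AB(6), of x y] in_prob_densities[of x y F] F(1) that by (auto simp: field_simps)
  define s where "s y = \<psi> (y - 1 + c, 1)" for y
  have less: "s y < s (y + x)" if "x > 0" for x y
  proof -
    (* With this value - (ln (1 + \<delta>) + ln (1 - \<delta>)) / 2 equals x. *)
    define \<delta> where "\<delta> = sqrt (1 - exp (- 2 * x))"
    have \<delta>2: "\<delta>\<^sup>2 = 1 - exp (- 2 * x)"
      using that by (simp add: \<delta>_def)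
    have \<delta>: "0 < \<delta>" "\<delta> < 1"
      using that by (auto simp: \<delta>_def real_sqrt_lt_1_iff)
    have ln: "ln (1 + \<delta>) + ln (1 - \<delta>) = - 2 * x"
    proof -
      have "ln (1 + \<delta>) + ln (1 - \<delta>) = ln ((1 + \<delta>) * (1 - \<delta>))"
        using \<delta> by (simp add: ln_mult)
      also have "(1 + \<delta>) * (1 - \<delta>) = exp (- 2 * x)"
        using \<delta>2 by (simp add: algebra_simps power2_eq_square)
      finally show ?thesis by simp
    qed
    define p where "p = two_step A B 1 1"
    define q where "q = two_step A B (1 + \<delta>) (1 - \<delta>)"
    have pq: "p \<in> ?P" "q \<in> ?P"
      using P \<delta> by (auto simp: p_def q_def)
    (* The undilated KL_score p p is 1; the dilation has to move it to y. *)
    define R where "R = exp (1 - y)"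
    have R: "R > 0" "ln R = 1 - y"
      by (auto simp: R_def)
    obtain \<sigma> :: "real ^ 'n ^ 'n" where \<sigma>: "invertible \<sigma>" "\<bar>det \<sigma>\<bar> = R"
      "\<And>f :: real ^ 'n \<Rightarrow> real. f \<in> borel_measurable lborel \<Longrightarrow>
        (LINT \<omega>|lborel. f (\<sigma> *v \<omega>)) = (LINT \<omega>|lborel. f \<omega>) / R"
      using dilation_with_determinant[OF R(1), where 'n='n] by blast
    have U_R: "U (R * z) = ereal (c - (1 - y) - ln z)" if "z > 0" for z
      using U R that by (simp add: elog_def ln_mult)
    have "pair_UV U V (affine_density \<sigma> 0 p) (affine_density \<sigma> 0 q) =
        ((c - (1 - y) - ln (1 + \<delta>) + (c - (1 - y) - ln (1 - \<delta>))) / 2, 1)"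
      unfolding p_def q_def using U_R[of "1 + \<delta>"] U_R[of "1 - \<delta>"] V \<delta> R(1)
      by (subst pair_UV_dilated[OF \<sigma>(3,2)]) (auto simp: field_simps)
    then have "pair_UV U V (affine_density \<sigma> 0 p) (affine_density \<sigma> 0 q) = (y + x - 1 + c, 1)"
      using ln by (simp add: field_simps)
    moreover have "pair_UV U V (affine_density \<sigma> 0 p) (affine_density \<sigma> 0 p) = (y - 1 + c, 1)"
      unfolding p_def using U_R[of 1] V R(1)
      by (subst pair_UV_dilated[OF \<sigma>(3,2)]) (auto simp: field_simps)
    ultimately have "h \<sigma> 0 * (s (y + x) - s y) = S p q - S p p"
      using h[OF \<sigma>(1) pq, of 0] S pq
      by (simp add: divergence_def score_formula_def s_def prob_densities_def)
    moreover have "S p p < S p q"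
      unfolding p_def q_def
      by (rule proper_strict[OF comp pq[unfolded p_def q_def] not_AE_eq]) (use \<delta> in simp)
    ultimately show ?thesis
      using h[OF \<sigma>(1) pq, of 0] zero_less_mult_pos[of "h \<sigma> 0" "s (y + x) - s y"] by simp
  qed
  have "strict_mono s"
  proof (rule strict_monoI)
    fix y y' :: real assume "y < y'"
    then show "s y < s y'" using less[of "y' - y" y] by simp
  qed
  moreover have "S p q = s (KL_score p q)" if "p \<in> ?P" "q \<in> ?P" for p q
  proof -
    have "p \<in> F" "q \<in> F"
      using that by (auto simp: prob_densities_def)
    then show ?thesis
      using S a pair_UV_log[OF F(2) that U V] by (simp add: condition_a_def score_formula_def s_def)
  qed
  ultimately show ?thesis
    unfolding equivalent_in_probability_def by blast
qed

section \<open>Monotone solutions of the scaling equation\<close>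

text \<open>Between consecutive integers \<open>i \<le> n s \<le> i + 1\<close> monotonicity traps both \<open>n g(s)\<close> and
  \<open>n s g(1)\<close> in the interval from \<open>i g(1)\<close> to \<open>(i + 1) g(1)\<close>, so they differ by at most \<open>g(1)\<close> for every \<open>n\<close>.\<close>

lemma monotone_additive_is_linear:
  fixes g :: "real \<Rightarrow> real"
  assumes "mono g" and add: "\<And>s t. g (s + t) = g s + g t"
  shows "g s = s * g 1"
proof -
  have g0: "g 0 = 0"
    using add[of 0 0] by simp
  have nat: "g (real n * s) = real n * g s" for n s
    by (induction n) (auto simp: g0 add algebra_simps)
  have neg: "g (- s) = - g s" for s
    using add[of s "- s"] g0 by simp
  have int: "g (of_int i) = of_int i * g 1" for i
    using nat[of "nat i" 1] neg[of "of_int i"] nat[of "nat (- i)" 1] by (cases "i \<ge> 0") auto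
  have bound: "real n * \<bar>g s - s * g 1\<bar> \<le> g 1" for n
  proof -
    define i where "i = \<lfloor>real n * s\<rfloor>"
    have i: "of_int i \<le> real n * s" "real n * s \<le> of_int (i + 1)"
      unfolding i_def by linarith+
    have "g (of_int i) \<le> g (real n * s)" "g (real n * s) \<le> g (of_int (i + 1))"
      using i \<open>mono g\<close> by (auto intro: monoD)
    then have a: "of_int i * g 1 \<le> real n * g s" "real n * g s \<le> (of_int i + 1) * g 1"
      unfolding int nat by auto
    have "g 1 \<ge> 0"
      using monoD[OF \<open>mono g\<close>, of 0 1] g0 by simp
    then have "of_int i * g 1 \<le> (real n * s) * g 1" "(real n * s) * g 1 \<le> (of_int i + 1) * g 1"
      using i by (auto intro: mult_right_mono)
    with a have "\<bar>real n * g s - (real n * s) * g 1\<bar> \<le> g 1"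
      by (simp add: algebra_simps abs_le_iff)
    then show ?thesis
      by (simp add: abs_mult right_diff_distrib[symmetric] mult.assoc)
  qed
  show ?thesis
  proof (rule ccontr)
    assume "g s \<noteq> s * g 1"
    then obtain n :: nat where "g 1 < real n * \<bar>g s - s * g 1\<bar>"
      using ex_less_of_nat_mult[of "\<bar>g s - s * g 1\<bar>" "g 1"] by auto
    with bound[of n] show False by simp
  qed
qed

text \<open>In logarithmic coordinates \<open>v / v 1\<close> is additive and increasing.\<close>

lemma monotone_homogeneous_is_power:
  fixes v k :: "real \<Rightarrow> real"
  assumes pos: "\<And>w. w > 0 \<Longrightarrow> v w > 0"
    and mono: "\<And>w w'. 0 < w \<Longrightarrow> w < w' \<Longrightarrow> v w < v w'"
    and hom: "\<And>t w. t > 0 \<Longrightarrow> w > 0 \<Longrightarrow> v (t * w) = k t * v w"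
  shows "\<exists>\<kappa>>0. (\<forall>w>0. v w = v 1 * w powr \<kappa>) \<and> (\<forall>t>0. k t = t powr \<kappa>)"
proof -
  define g where "g s = ln (v (exp s) / v 1)" for s
  have k: "k t = v t / v 1" if "t > 0" for t
    using hom[of t 1] that pos[of 1] by simp
  have lt: "g s < g t" if "s < t" for s t
    unfolding g_def using mono[of "exp s" "exp t"] pos[of 1] pos[of "exp s"] pos[of "exp t"] that
    by (subst ln_less_cancel_iff) (auto simp: divide_strict_right_mono)
  have add: "g (s + t) = g s + g t" for s t
    unfolding g_def using hom[of "exp s" "exp t"] k[of "exp s"] pos[of 1] pos[of "exp s"] pos[of "exp t"]
    by (simp add: exp_add ln_mult ln_div)
  have "mono g"
    by (intro monoI) (use lt in \<open>auto simp: le_less\<close>)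
  then have lin: "g s = s * g 1" for s
    using add by (rule monotone_additive_is_linear)
  have v: "v w / v 1 = w powr g 1" if "w > 0" for w
    using lin[of "ln w"] that pos[of w] pos[of 1] exp_ln[of "v w / v 1"]
    by (simp add: g_def powr_def mult.commute)
  show ?thesis
  proof (intro exI[of _ "g 1"] conjI allI impI)
    show "g 1 > 0"
      using lt[of 0 1] add[of 0 0] by simp
    show "v w = v 1 * w powr g 1" if "w > 0" for w
      using v[OF that] pos[of 1] by (simp add: field_simps)
    show "k t = t powr g 1" if "t > 0" for t
      using v[OF that] k[OF that] by simp
  qed
qed

text \<open>The odd extension of the \<open>\<kappa>\<close>-th root. Negative arguments occur on the diagonal, where
  \<open>\<Phi> w w < A\<close>; positive ones occur wherever the score exceeds the supremum \<open>A\<close> of its diagonal.\<close>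

definition signed_root :: "real \<Rightarrow> real \<Rightarrow> real" where
  "signed_root \<kappa> s = sgn s * \<bar>s\<bar> powr (1 / \<kappa>)"

lemma strict_mono_signed_root:
  assumes "\<kappa> > 0"
  shows "strict_mono (signed_root \<kappa>)"
proof (rule strict_monoI)
  fix s t :: real
  assume "s < t"
  have less: "x powr (1 / \<kappa>) < y powr (1 / \<kappa>)" if "0 \<le> x" "x < y" for x y
    using that assms by (intro powr_less_mono2) auto
  consider "t \<le> 0" | "s < 0" "0 < t" | "0 \<le> s"
    by linarith
  then show "signed_root \<kappa> s < signed_root \<kappa> t"
  proof cases
    case 1
    with \<open>s < t\<close> show ?thesis
      using less[of "- t" "- s"] by (cases "t = 0") (auto simp: signed_root_def)
  next
    case 2
    have "- ((- s) powr (1 / \<kappa>)) < 0" "0 < t powr (1 / \<kappa>)"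
      using 2 by auto
    then have "- ((- s) powr (1 / \<kappa>)) < t powr (1 / \<kappa>)"
      by linarith
    with 2 show ?thesis
      by (simp add: signed_root_def)
  next
    case 3
    with \<open>s < t\<close> show ?thesis
      using less[of s t] by (cases "s = 0") (auto simp: signed_root_def)
  qed
qed

lemma signed_root_homogeneous:
  assumes "\<kappa> > 0" "t > 0"
  shows "signed_root \<kappa> (t powr \<kappa> * s) = t * signed_root \<kappa> s"
  using assms by (simp add: signed_root_def abs_mult sgn_mult powr_mult powr_powr)

lemma signed_root_minus_powr:
  assumes "\<kappa> > 0" "w > 0"
  shows "signed_root \<kappa> (- (w powr \<kappa>)) = - w"
  using assms by (simp add: signed_root_def powr_powr)

text \<open>The part of the power case that does not involve integration: \<open>P\<close> stands for the set of
  probability densities, and the hypotheses \<open>decreasing\<close>, \<open>disjoint\<close> and \<open>sharp\<close> are what the choice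
  of test densities has to provide. Two facts come from \<open>disjoint\<close>: the value \<open>\<Phi> 0 1\<close> bounds
  \<open>u w = \<Phi> w w\<close> from above, and, being common to all \<open>w\<close>, it cancels between two instances of
  \<open>scaling\<close>, which leaves an equation for \<open>u\<close> alone.\<close>

lemma increasing_transform_to_homogeneous_form:
  fixes X :: "'f \<Rightarrow> 'f \<Rightarrow> real" and Y :: "'f \<Rightarrow> real" and \<Phi> :: "real \<Rightarrow> real \<Rightarrow> real"
  assumes scaling: "\<And>t. t > 0 \<Longrightarrow> \<exists>k>0. \<forall>p\<in>P. \<forall>q\<in>P.
        \<Phi> (t * X p q) (t * Y q) - \<Phi> (t * Y p) (t * Y p) = k * (\<Phi> (X p q) (Y q) - \<Phi> (Y p) (Y p))"
    and Y_pos: "\<And>p. p \<in> P \<Longrightarrow> Y p > 0"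
    and score: "\<And>p q. p \<in> P \<Longrightarrow> q \<in> P \<Longrightarrow> \<Phi> (Y p) (Y p) \<le> \<Phi> (X p q) (Y q)"
    and decreasing: "\<And>w w'. 0 < w \<Longrightarrow> w < w' \<Longrightarrow> \<Phi> w' w' < \<Phi> w w"
    and disjoint: "\<And>w. w > 0 \<Longrightarrow> \<exists>p\<in>P. \<exists>q\<in>P. X p q = 0 \<and> Y q = 1 \<and> Y p = w"
    and sharp: "\<And>z e. z \<ge> 0 \<Longrightarrow> e > 0 \<Longrightarrow>
        \<exists>p\<in>P. \<exists>q\<in>P. X p q = z * Y q \<and> Y p \<le> (z powr (1 + \<gamma>) + e) * Y q"
  obtains \<xi> \<phi> :: "real \<Rightarrow> real" where "strict_mono \<xi>" "\<phi> 1 = - 1"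
    "\<And>z. z \<ge> 0 \<Longrightarrow> \<phi> z \<ge> - (z powr (1 + \<gamma>))"
    "\<And>p q. p \<in> P \<Longrightarrow> q \<in> P \<Longrightarrow> \<phi> (X p q / Y q) * Y q = \<xi> (\<Phi> (X p q) (Y q))"
proof -
  define u where "u w = \<Phi> w w" for w
  obtain k where k_pos: "\<And>t. t > 0 \<Longrightarrow> k t > 0"
    and k: "\<And>t p q. t > 0 \<Longrightarrow> p \<in> P \<Longrightarrow> q \<in> P \<Longrightarrow>
        \<Phi> (t * X p q) (t * Y q) - u (t * Y p) = k t * (\<Phi> (X p q) (Y q) - u (Y p))"
    using scaling unfolding u_def by metis
  define A where "A = (SUP w\<in>{0<..}. u w)"
  have bdd: "bdd_above (u ` {0<..})"
    using disjoint score by (intro bdd_aboveI[of _ "\<Phi> 0 1"]) (force simp: u_def)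
  have u_le: "u w \<le> A" if "w > 0" for w
    unfolding A_def using that bdd by (intro cSUP_upper) auto
  have A_le: "A \<le> C" if "\<And>w. w > 0 \<Longrightarrow> u w \<le> C" for C
    unfolding A_def using that by (intro cSUP_least) auto
  have diff: "u (t * w) - u (t * w') = k t * (u w - u w')" if "t > 0" "w > 0" "w' > 0" for t w w'
  proof -
    have *: "\<Phi> 0 t - u (t * w) = k t * (\<Phi> 0 1 - u w)" if "w > 0" for w
      using disjoint[OF that] k[OF \<open>t > 0\<close>] by force
    show ?thesis
      using *[OF \<open>w > 0\<close>] *[OF \<open>w' > 0\<close>] by (simp add: algebra_simps)
  qed
  (* u (t * w) is an increasing affine function of u w, and a dilation permutes the values of u;
     so the supremum of u is a fixed point of that affine function. *)
  have gap: "A - u (t * w) = k t * (A - u w)" if "t > 0" "w > 0" for t w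
  proof (rule antisym)
    have "u w' \<le> u (t * w) + k t * (A - u w)" if "w' > 0" for w'
    proof -
      have "k t * (u (w' / t) - u w) \<le> k t * (A - u w)"
        using k_pos[OF \<open>t > 0\<close>] u_le[of "w' / t"] that \<open>t > 0\<close> by (intro mult_left_mono) auto
      then show ?thesis
        using diff[OF \<open>t > 0\<close> _ \<open>w > 0\<close>, of "w' / t"] that \<open>t > 0\<close> by simp
    qed
    from A_le[OF this] show "A - u (t * w) \<le> k t * (A - u w)" by simp
    have "u w' \<le> u w + (A - u (t * w)) / k t" if "w' > 0" for w'
    proof -
      have "k t * (u w' - u w) \<le> A - u (t * w)"
        using diff[OF \<open>t > 0\<close> that \<open>w > 0\<close>] u_le[of "t * w'"] that \<open>t > 0\<close> by simp
      then have "u w' - u w \<le> (A - u (t * w)) / k t"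
        using k_pos[OF \<open>t > 0\<close>] by (simp add: pos_le_divide_eq mult.commute)
      then show ?thesis by simp
    qed
    from A_le[OF this] have "A - u w \<le> (A - u (t * w)) / k t" by simp
    then show "k t * (A - u w) \<le> A - u (t * w)"
      unfolding pos_le_divide_eq[OF k_pos[OF \<open>t > 0\<close>]] by (simp only: mult.commute)
  qed
  have u_less: "u w < A" if "w > 0" for w
    using decreasing[of "w / 2" w] u_le[of "w / 2"] that by (simp add: u_def)
  have gap_pos: "0 < A - u w" if "w > 0" for w
    using u_less[OF that] by simp
  have gap_mono: "A - u w < A - u w'" if "0 < w" "w < w'" for w w'
    using decreasing[OF that] by (simp add: u_def)
  have "\<exists>\<kappa>>0. (\<forall>w>0. A - u w = (A - u 1) * w powr \<kappa>) \<and> (\<forall>t>0. k t = t powr \<kappa>)"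
    by (rule monotone_homogeneous_is_power) (fact gap_pos, fact gap_mono, fact gap)
  then obtain \<kappa> where \<kappa>: "\<kappa> > 0" "\<And>w. w > 0 \<Longrightarrow> A - u w = (A - u 1) * w powr \<kappa>"
    "\<And>t. t > 0 \<Longrightarrow> k t = t powr \<kappa>"
    by blast
  define B where "B = A - u 1"
  have B: "B > 0"
    using u_less[of 1] by (simp add: B_def)
  define \<xi> where "\<xi> v = signed_root \<kappa> ((v - A) / B)" for v
  have mono: "strict_mono \<xi>"
    unfolding \<xi>_def using strict_monoD[OF strict_mono_signed_root[OF \<kappa>(1)]] B
    by (intro strict_monoI) (auto simp: divide_strict_right_mono)
  have \<xi>_u: "\<xi> (u w) = - w" if "w > 0" for w
  proof -
    have "(u w - A) / B = - (w powr \<kappa>)"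
      using \<kappa>(2)[OF that] B unfolding B_def[symmetric] by (simp add: field_simps)
    then show ?thesis
      using signed_root_minus_powr[OF \<kappa>(1) that] by (simp add: \<xi>_def)
  qed
  have hom: "\<xi> (\<Phi> (t * X p q) (t * Y q)) = t * \<xi> (\<Phi> (X p q) (Y q))"
    if "t > 0" "p \<in> P" "q \<in> P" for t p q
  proof -
    have "\<Phi> (t * X p q) (t * Y q) - A = t powr \<kappa> * (\<Phi> (X p q) (Y q) - A)"
      using k[OF that] gap[OF that(1) Y_pos[OF that(2)]] \<kappa>(3)[OF that(1)] by (simp add: algebra_simps)
    then show ?thesis
      using signed_root_homogeneous[OF \<kappa>(1) that(1)] by (simp add: \<xi>_def flip: times_divide_eq_right)
  qed
  define \<phi> where "\<phi> z = \<xi> (\<Phi> z 1)" for z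
  have form: "\<phi> (X p q / Y q) * Y q = \<xi> (\<Phi> (X p q) (Y q))" if "p \<in> P" "q \<in> P" for p q
    using hom[of "1 / Y q", OF _ that] Y_pos[OF that(2)] by (simp add: \<phi>_def)
  show thesis
  proof (rule that[OF mono _ _ form])
    show "\<phi> 1 = - 1"
      using \<xi>_u[of 1] by (simp add: \<phi>_def u_def)
    show "- (z powr (1 + \<gamma>)) \<le> \<phi> z" if "z \<ge> 0" for z
    proof (rule field_le_epsilon)
      fix e :: real
      assume "e > 0"
      then obtain p q where pq: "p \<in> P" "q \<in> P" "X p q = z * Y q" "Y p \<le> (z powr (1 + \<gamma>) + e) * Y q"
        using sharp[OF \<open>z \<ge> 0\<close>] by blast
      have "- Y p = \<xi> (u (Y p))"
        using \<xi>_u Y_pos pq by simp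
      also have "\<dots> \<le> \<xi> (\<Phi> (X p q) (Y q))"
        using score[OF pq(1,2)] strict_mono_mono[OF mono] by (auto simp: u_def intro: monoD)
      also have "\<dots> = \<phi> z * Y q"
        using form[OF pq(1,2)] Y_pos[OF pq(2)] pq(3) by simp
      finally have "0 \<le> (\<phi> z + (z powr (1 + \<gamma>) + e)) * Y q"
        using pq(4) by (simp add: algebra_simps)
      then show "- (z powr (1 + \<gamma>)) \<le> \<phi> z + e"
        using Y_pos[OF pq(2)] by (simp add: zero_le_mult_iff)
    qed
  qed
qed


section \<open>The power score\<close>

text \<open>Dilating a density by \<open>R\<close> multiplies \<open>p q\<^sup>\<gamma>\<close> by \<open>R\<^sup>1\<^sup>+\<^sup>\<gamma>\<close>, and the change of variables
  takes one factor \<open>R\<close> back. The constant \<open>c\<close> is multiplied by \<open>\<langle>p\<rangle> = 1\<close> at every scale.\<close>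

lemma pair_UV_power_dilated:
  fixes p q :: "real ^ 'n \<Rightarrow> real"
  assumes F: "F \<subseteq> L0_pos" and p: "p \<in> prob_densities F" and q: "q \<in> prob_densities F"
    and U: "\<forall>z\<ge>0. U z = ereal (z powr \<gamma> + c)" and V: "\<forall>z\<ge>0. V z = z powr (1 + \<gamma>)"
    and ex: "pair_UV_exists U V p q"
    and dil: "\<And>f :: real ^ 'n \<Rightarrow> real. f \<in> borel_measurable lborel \<Longrightarrow>
        (LINT \<omega>|lborel. f (\<sigma> *v \<omega>)) = (LINT \<omega>|lborel. f \<omega>) / R"
    and R: "\<bar>det \<sigma>\<bar> = R" "R > 0"
  shows "pair_UV U V (affine_density \<sigma> 0 p) (affine_density \<sigma> 0 q) =
    (R powr \<gamma> * (LINT \<omega>|lborel. p \<omega> * q \<omega> powr \<gamma>) + c, R powr \<gamma> * (LINT \<omega>|lborel. q \<omega> powr (1 + \<gamma>)))"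
proof -
  note p' = prob_densitiesD[OF p F] and q' = prob_densitiesD[OF q F]
  note [measurable] = p'(2) q'(2)
  have "integrable lborel (\<lambda>\<omega>. p \<omega> * (q \<omega> powr \<gamma> + c))"
    using ex ext_integrable_integrable[of lborel "\<lambda>\<omega>. ereal (p \<omega>) * U (q \<omega>)"] U q'(3)
    by (simp add: pair_UV_exists_def)
  from Bochner_Integration.integrable_diff[OF this integrable_mult_right[OF p'(4), of c]]
  have int: "integrable lborel (\<lambda>\<omega>. p \<omega> * q \<omega> powr \<gamma>)"
    by (simp add: algebra_simps)
  have "ext_integral lborel (\<lambda>\<omega>. ereal (affine_density \<sigma> 0 p \<omega>) * U (affine_density \<sigma> 0 q \<omega>)) =
      (LINT \<omega>|lborel. (\<lambda>\<omega>. (R * R powr \<gamma>) * (p \<omega> * q \<omega> powr \<gamma>) + (R * c) * p \<omega>) (\<sigma> *v \<omega>))"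
    unfolding ext_integral_def using U p'(3) q'(3) R
    by (intro Bochner_Integration.integral_cong)
       (auto simp: affine_density_def powr_mult algebra_simps)
  also have "\<dots> = ((R * R powr \<gamma>) * (LINT \<omega>|lborel. p \<omega> * q \<omega> powr \<gamma>) + R * c) / R"
    by (subst dil) (use int p' in auto)
  also have "\<dots> = R powr \<gamma> * (LINT \<omega>|lborel. p \<omega> * q \<omega> powr \<gamma>) + c"
    using R(2) by (simp add: field_simps)
  finally have 1: "ext_integral lborel (\<lambda>\<omega>. ereal (affine_density \<sigma> 0 p \<omega>) * U (affine_density \<sigma> 0 q \<omega>)) = \<dots>" .
  have "(LINT \<omega>|lborel. V (affine_density \<sigma> 0 q \<omega>)) =
      (LINT \<omega>|lborel. (\<lambda>\<omega>. (R * R powr \<gamma>) * q \<omega> powr (1 + \<gamma>)) (\<sigma> *v \<omega>))"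
    using V q'(3) R
    by (intro Bochner_Integration.integral_cong)
       (auto simp: affine_density_def powr_mult powr_mult_base)
  also have "\<dots> = R powr \<gamma> * (LINT \<omega>|lborel. q \<omega> powr (1 + \<gamma>))"
    by (subst dil) (use R(2) in auto)
  finally show ?thesis
    using 1 by (simp add: pair_UV_def)
qed

lemma two_step_densities_exist:
  fixes \<gamma> \<alpha> \<beta> a b a' b' :: real
  assumes "\<alpha> > 0" "\<beta> > 0" "a \<ge> 0" "b \<ge> 0" "a' \<ge> 0" "b' \<ge> 0"
    and "a * \<alpha> + b * \<beta> = 1" "a' * \<alpha> + b' * \<beta> = 1"
  obtains p q :: "real ^ 'n \<Rightarrow> real" where
    "p \<in> prob_densities (L_pos \<gamma>)" "q \<in> prob_densities (L_pos \<gamma>)"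
    "(LINT \<omega>|lborel. p \<omega> * q \<omega> powr \<gamma>) = a * a' powr \<gamma> * \<alpha> + b * b' powr \<gamma> * \<beta>"
    "(LINT \<omega>|lborel. p \<omega> powr (1 + \<gamma>)) = a * a powr \<gamma> * \<alpha> + b * b powr \<gamma> * \<beta>"
    "(LINT \<omega>|lborel. q \<omega> powr (1 + \<gamma>)) = a' * a' powr \<gamma> * \<alpha> + b' * b' powr \<gamma> * \<beta>"
    "b \<noteq> b' \<Longrightarrow> \<not> (AE \<omega> in lborel. p \<omega> = q \<omega>)"
proof -
  obtain A B :: "(real ^ 'n) set" where AB: "A \<in> sets lborel" "B \<in> sets lborel" "A \<inter> B = {}"
    "emeasure lborel A = ennreal \<alpha>" "emeasure lborel B = ennreal \<beta>"
    by (rule disjoint_blocks_exist[OF assms(1,2)]) auto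
  interpret two_blocks A B \<alpha> \<beta>
    by unfold_locales (use AB assms in auto)
  show thesis
  proof (rule that)
    show "two_step A B a b \<in> prob_densities (L_pos \<gamma>)" "two_step A B a' b' \<in> prob_densities (L_pos \<gamma>)"
      using in_prob_densities in_L_pos assms by auto
  qed (use assms power_integrals not_AE_eq in \<open>simp_all add: powr_mult_base\<close>)
qed

text \<open>Equality in Hoelder's inequality would need \<open>p\<close> proportional to \<open>q\<close>, that is \<open>z = 1\<close> for
  probability densities. For other \<open>z\<close> the density that is too small on the common support
  keeps its missing mass on a second block, on which it is so small that its power integral is negligible. For \<open>z \<le> 1\<close>
  this is \<open>p\<close>, equal to \<open>z\<close> on a unit block where \<open>q = 1\<close>. For \<open>z > 1\<close> it is \<open>q\<close>, equal to a
  number \<open>a\<close> slightly below \<open>1 / z\<close> where \<open>p = 1\<close>.\<close>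

lemma sharp_pair_exists:
  fixes \<gamma> z e :: real
  assumes "\<gamma> > 0" "z \<ge> 0" "e > 0"
  shows "\<exists>p\<in>prob_densities (L_pos \<gamma> :: (real ^ 'n \<Rightarrow> real) set). \<exists>q\<in>prob_densities (L_pos \<gamma>).
     (LINT \<omega>|lborel. p \<omega> * q \<omega> powr \<gamma>) = z * (LINT \<omega>|lborel. q \<omega> powr (1 + \<gamma>)) \<and>
     (LINT \<omega>|lborel. p \<omega> powr (1 + \<gamma>)) \<le> (z powr (1 + \<gamma>) + e) * (LINT \<omega>|lborel. q \<omega> powr (1 + \<gamma>))"
proof (cases "z \<le> 1")
  case True
  (* The power integral of p on the second block is (1 - z)^(1 + \<gamma>) * \<eta>^\<gamma>, at most e. *)
  define \<eta> where "\<eta> = e powr (1 / \<gamma>)"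
  have \<eta>: "\<eta> > 0" "\<eta> powr \<gamma> = e"
    using assms by (auto simp: \<eta>_def powr_powr)
  have "(1 - z) * (1 - z) powr \<gamma> \<le> 1 * 1 powr \<gamma>"
    using True assms by (intro mult_mono powr_mono2) auto
  then have le: "(1 - z) * (1 - z) powr \<gamma> * e \<le> e"
    using assms by (simp add: mult_le_cancel_right1)
  obtain p q :: "real ^ 'n \<Rightarrow> real" where pq: "p \<in> prob_densities (L_pos \<gamma>)" "q \<in> prob_densities (L_pos \<gamma>)"
    and int: "(LINT \<omega>|lborel. p \<omega> * q \<omega> powr \<gamma>) = z"
    "(LINT \<omega>|lborel. p \<omega> powr (1 + \<gamma>)) = z * z powr \<gamma> + (1 - z) * (1 - z) powr \<gamma> * e"
    "(LINT \<omega>|lborel. q \<omega> powr (1 + \<gamma>)) = 1"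
    by (rule two_step_densities_exist[of 1 "1 / \<eta>" z "(1 - z) * \<eta>" 1 0 \<gamma>])
       (use \<eta> True assms in \<open>auto simp: powr_mult mult.assoc\<close>)
  have "z powr (1 + \<gamma>) = z * z powr \<gamma>"
    using assms by (simp add: powr_mult_base)
  with int le show ?thesis
    by (intro bexI[OF bexI[OF _ pq(2)] pq(1)]) simp
next
  case False
  then have z: "z > 1" by simp
  define W where "W = z powr (1 + \<gamma>) + e"
  (* Once X = a^\<gamma> and Y q = a^\<gamma> / z, the ratio Y p / Y q is z / a^\<gamma>; it has to equal W. *)
  define a where "a = (z / W) powr (1 / \<gamma>)"
  have W: "W > 0"
    using z assms by (simp add: W_def add_pos_pos)
  have a: "a > 0" "a powr \<gamma> = z / W"
    using W z assms by (auto simp: a_def powr_powr)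
  have "z / W < (1 / z) powr \<gamma>"
    using W z assms by (simp add: powr_divide divide_less_eq less_divide_eq W_def powr_add field_simps)
  then have az: "a < 1 / z"
    using a powr_mono2[of \<gamma> "1 / z" a] assms z by fastforce
  have a1: "a < 1"
    using az z by (smt (verit) divide_less_eq_1)
  (* The second block has mass 1 - a, and \<rho> = b^\<gamma> is the value for which q has power integral a^\<gamma> / z. *)
  define \<rho> where "\<rho> = a powr \<gamma> * (1 / z - a) / (1 - a)"
  have \<rho>: "\<rho> > 0"
    unfolding \<rho>_def using a(1) az a1 by (intro divide_pos_pos mult_pos_pos) auto
  define b where "b = \<rho> powr (1 / \<gamma>)"
  have b: "b > 0" "b powr \<gamma> = \<rho>"
    using \<rho> assms by (auto simp: b_def powr_powr)
  obtain p q :: "real ^ 'n \<Rightarrow> real" where pq: "p \<in> prob_densities (L_pos \<gamma>)" "q \<in> prob_densities (L_pos \<gamma>)"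
    and int: "(LINT \<omega>|lborel. p \<omega> * q \<omega> powr \<gamma>) = a powr \<gamma>"
    "(LINT \<omega>|lborel. p \<omega> powr (1 + \<gamma>)) = 1"
    "(LINT \<omega>|lborel. q \<omega> powr (1 + \<gamma>)) = a * a powr \<gamma> + b * \<rho> * ((1 - a) / b)"
    by (rule two_step_densities_exist[of 1 "(1 - a) / b" 1 0 a b \<gamma>]) (use a b a1 in auto)
  have "b * \<rho> * ((1 - a) / b) = a powr \<gamma> * (1 / z - a)"
    using b a1 by (simp add: \<rho>_def)
  then have "(LINT \<omega>|lborel. q \<omega> powr (1 + \<gamma>)) = a powr \<gamma> / z"
    using int(3) by (simp add: algebra_simps)
  with int(1,2) a(2) W z show ?thesis
    unfolding W_def[symmetric] by (intro bexI[OF bexI[OF _ pq(2)] pq(1)]) simp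
qed

text \<open>The values \<open>Y\<close> of uniform densities are arbitrary: a density that is uniform on a set of
  measure \<open>1 / M\<close> has \<open>Y = M\<^sup>\<gamma>\<close>, and \<open>X p q = Y q\<close> if \<open>q\<close> is uniform on a set that contains
  the support of \<open>p\<close>.\<close>

lemma power_score_transforms_to_Holder:
  fixes F :: "(real ^ 'n \<Rightarrow> real) set"
  assumes F: "F \<subseteq> L0_pos" "F = L_pos \<gamma>" and a: "condition_a F U V"
    and comp: "composite_score F S"
    and S: "\<forall>f\<in>F. \<forall>g\<in>F. S f g = score_formula U V \<psi> f g"
    and aff: "affine_invariant F U V \<Psi> \<psi>"
    and \<gamma>: "\<gamma> > 0" and U: "\<forall>z\<ge>0. U z = ereal (z powr \<gamma> + c)" and V: "\<forall>z\<ge>0. V z = z powr (1 + \<gamma>)"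
  shows "\<exists>\<phi> :: real \<Rightarrow> real. \<phi> 1 = - 1 \<and> (\<forall>z\<ge>0. \<phi> z \<ge> - (z powr (1 + \<gamma>))) \<and>
               equivalent_in_probability F S (Holder_score \<gamma> \<phi>)"
proof -
  let ?P = "prob_densities F"
  define X where "X p q = (LINT \<omega>|lborel. p \<omega> * q \<omega> powr \<gamma>)" for p q :: "real ^ 'n \<Rightarrow> real"
  define Y where "Y q = (LINT \<omega>|lborel. q \<omega> powr (1 + \<gamma>))" for q :: "real ^ 'n \<Rightarrow> real"
  define \<Phi> where "\<Phi> x y = \<psi> (x + c, y)" for x y
  obtain h where h: "\<And>\<sigma> \<mu>. invertible \<sigma> \<Longrightarrow> 0 < h \<sigma> \<mu>" "\<And>\<sigma> \<mu> p q. invertible \<sigma> \<Longrightarrow> p \<in> ?P \<Longrightarrow> q \<in> ?P \<Longrightarrow>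
      h \<sigma> \<mu> * divergence (score_formula U V \<psi>) (affine_density \<sigma> \<mu> p) (affine_density \<sigma> \<mu> q)
       = divergence (score_formula U V \<psi>) p q"
    using aff unfolding affine_invariant_def by metis
  have in_F: "p \<in> F" if "p \<in> ?P" for p
    using that by (simp add: prob_densities_def)
  have ex: "pair_UV_exists U V p q" if "p \<in> ?P" "q \<in> ?P" for p q
    using a in_F that by (simp add: condition_a_def)
  have XX: "X p p = Y p" if "p \<in> ?P" for p
    using prob_densitiesD(3)[OF that F(1)] by (simp add: X_def Y_def powr_mult_base)
  have S': "S p q = \<Phi> (X p q) (Y q)" if "p \<in> ?P" "q \<in> ?P" for p q
    using pair_UV_power_dilated[OF F(1) that U V ex[OF that], of "mat 1" 1] S in_F that
    by (simp add: score_formula_def \<Phi>_def X_def Y_def affine_density_def)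
  have scaling: "\<exists>k>0. \<forall>p\<in>?P. \<forall>q\<in>?P.
      \<Phi> (t * X p q) (t * Y q) - \<Phi> (t * Y p) (t * Y p) = k * (\<Phi> (X p q) (Y q) - \<Phi> (Y p) (Y p))"
    if "t > 0" for t
  proof -
    define R where "R = t powr (1 / \<gamma>)"
    have R: "R > 0" "R powr \<gamma> = t"
      using that \<gamma> by (auto simp: R_def powr_powr)
    obtain \<sigma> :: "real ^ 'n ^ 'n" where \<sigma>: "invertible \<sigma>" "\<bar>det \<sigma>\<bar> = R"
      "\<And>f :: real ^ 'n \<Rightarrow> real. f \<in> borel_measurable lborel \<Longrightarrow>
        (LINT \<omega>|lborel. f (\<sigma> *v \<omega>)) = (LINT \<omega>|lborel. f \<omega>) / R"
      using dilation_with_determinant[OF R(1), where 'n='n] by blast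
    have *: "score_formula U V \<psi> (affine_density \<sigma> 0 p) (affine_density \<sigma> 0 q) = \<Phi> (t * X p q) (t * Y q)"
      if "p \<in> ?P" "q \<in> ?P" for p q
      using pair_UV_power_dilated[OF F(1) that U V ex[OF that] \<sigma>(3,2) R(1)] R(2)
      by (simp add: score_formula_def \<Phi>_def X_def Y_def)
    show ?thesis
    proof (intro exI[of _ "1 / h \<sigma> 0"] conjI ballI)
      show "1 / h \<sigma> 0 > 0"
        using h(1)[OF \<sigma>(1)] by simp
      fix p q assume pq: "p \<in> ?P" "q \<in> ?P"
      have "h \<sigma> 0 * (\<Phi> (t * X p q) (t * Y q) - \<Phi> (t * Y p) (t * Y p)) = \<Phi> (X p q) (Y q) - \<Phi> (Y p) (Y p)"
        using h(2)[OF \<sigma>(1) pq, of 0] S in_F pq S'[OF pq] S'[OF pq(1,1)]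
        by (simp add: divergence_def * XX)
      then show "\<Phi> (t * X p q) (t * Y q) - \<Phi> (t * Y p) (t * Y p) = 1 / h \<sigma> 0 * (\<Phi> (X p q) (Y q) - \<Phi> (Y p) (Y p))"
        using h(1)[OF \<sigma>(1), of 0] by (simp add: field_simps)
    qed
  qed
  have Y_pos: "Y p > 0" if "p \<in> ?P" for p
  proof -
    note p' = prob_densitiesD[OF that F(1)]
    have int: "integrable lborel (\<lambda>\<omega>. p \<omega> powr (1 + \<gamma>))"
      using p'(1) F(2) by (simp add: L_pos_def)
    have "\<not> (AE \<omega> in lborel. p \<omega> powr (1 + \<gamma>) = 0)"
      using p'(6) by simp
    then have "Y p \<noteq> 0"
      unfolding Y_def using integral_nonneg_eq_0_iff_AE[OF int] by simp
    moreover have "Y p \<ge> 0"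
      unfolding Y_def by (intro integral_nonneg_AE) auto
    ultimately show ?thesis by simp
  qed
  have score: "\<Phi> (Y p) (Y p) \<le> \<Phi> (X p q) (Y q)" if "p \<in> ?P" "q \<in> ?P" for p q
  proof -
    have "S p p \<le> S p q"
      using comp in_F that by (simp add: composite_score_def)
    then show ?thesis
      using S' XX that by simp
  qed
  have decreasing: "\<Phi> w' w' < \<Phi> w w" if "0 < w" "w < w'" for w w'
  proof -
    define m M where "m = w powr (1 / \<gamma>)" and "M = w' powr (1 / \<gamma>)"
    have m: "0 < m" "m < M" "m powr \<gamma> = w" "M powr \<gamma> = w'"
      using that \<gamma> by (auto simp: m_def M_def powr_powr intro: powr_less_mono2)
    (* q is uniform on a set of measure 1 / m, and p on a part of it of measure 1 / M. *)
    obtain p q :: "real ^ 'n \<Rightarrow> real" where pq: "p \<in> ?P" "q \<in> ?P"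
      and int: "X p q = M * w * (1 / M)" "Y p = M * w' * (1 / M)"
        "Y q = m * w * (1 / M) + m * w * (1 / m - 1 / M)"
      and ne: "\<not> (AE \<omega> in lborel. p \<omega> = q \<omega>)"
      by (rule two_step_densities_exist[of "1 / M" "1 / m - 1 / M" M 0 m m \<gamma>])
         (use m in \<open>auto simp: X_def Y_def F(2) field_simps\<close>)
    have "X p q = w" "Y p = w'" "Y q = w"
      using int m by (auto simp: field_simps)
    then show ?thesis
      using proper_strict[OF comp pq ne] S'[OF pq(1,1)] S'[OF pq] XX[OF pq(1)] by simp
  qed
  have disjoint: "\<exists>p\<in>?P. \<exists>q\<in>?P. X p q = 0 \<and> Y q = 1 \<and> Y p = w" if "w > 0" for w
  proof -
    define M where "M = w powr (1 / \<gamma>)"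
    have M: "M > 0" "M powr \<gamma> = w"
      using that \<gamma> by (auto simp: M_def powr_powr)
    obtain p q :: "real ^ 'n \<Rightarrow> real" where pq: "p \<in> ?P" "q \<in> ?P"
      and int: "X p q = 0" "Y p = w" "Y q = 1"
      by (rule two_step_densities_exist[of "1 / M" 1 M 0 0 1 \<gamma>])
         (use M in \<open>auto simp: X_def Y_def F(2)\<close>)
    then show ?thesis by blast
  qed
  have sharp: "\<exists>p\<in>?P. \<exists>q\<in>?P. X p q = z * Y q \<and> Y p \<le> (z powr (1 + \<gamma>) + e) * Y q"
    if "z \<ge> 0" "e > 0" for z e
    using sharp_pair_exists[OF \<gamma> that] unfolding X_def Y_def F(2) .
  obtain \<xi> \<phi> :: "real \<Rightarrow> real" where "strict_mono \<xi>" "\<phi> 1 = - 1"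
    "\<And>z. z \<ge> 0 \<Longrightarrow> \<phi> z \<ge> - (z powr (1 + \<gamma>))"
    "\<And>p q. p \<in> ?P \<Longrightarrow> q \<in> ?P \<Longrightarrow> \<phi> (X p q / Y q) * Y q = \<xi> (\<Phi> (X p q) (Y q))"
    using increasing_transform_to_homogeneous_form[OF scaling Y_pos score decreasing disjoint sharp] by blast
  then show ?thesis
    unfolding equivalent_in_probability_def Holder_score_def X_def[symmetric] Y_def[symmetric]
    using S' by (intro exI[of _ \<phi>]) auto
qed



section \<open>Affine invariant composite scores\<close>

theorem theorem4:
  fixes F :: "(real ^ 'n \<Rightarrow> real) set"
    and S :: "(real ^ 'n \<Rightarrow> real) \<Rightarrow> (real ^ 'n \<Rightarrow> real) \<Rightarrow> real"
    and U :: "real \<Rightarrow> ereal" and V :: "real \<Rightarrow> real"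
    and \<Psi> :: "(real \<times> real) set" and \<psi> :: "real \<times> real \<Rightarrow> real"
  assumes "convex_funs F" and "F0 \<subseteq> F" and "F \<subseteq> L0_pos"
    and "condition_a F U V" and "condition_b U V" and "condition_c F U V \<Psi> \<psi>"
    and "composite_score F S"
    and "\<forall>f\<in>F. \<forall>g\<in>F. S f g = score_formula U V \<psi> f g"
    and "affine_invariant F U V \<Psi> \<psi>"
  shows "(\<forall>c::real. (\<forall>z\<ge>0. U z = - elog z + ereal c) \<and> (\<forall>z\<ge>0. V z = z) \<longrightarrow>
            equivalent_in_probability F KL_score S) \<and>
         (\<forall>\<gamma> c :: real. \<gamma> > 0 \<and> (\<forall>z\<ge>0. U z = ereal (z powr \<gamma> + c)) \<and>
            (\<forall>z\<ge>0. V z = z powr (1 + \<gamma>)) \<and> F = L_pos \<gamma> \<longrightarrow>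
            (\<exists>\<phi> :: real \<Rightarrow> real. \<phi> 1 = - 1 \<and> (\<forall>z\<ge>0. \<phi> z \<ge> - (z powr (1 + \<gamma>))) \<and>
               equivalent_in_probability F S (Holder_score \<gamma> \<phi>)))"
  using log_score_increasing_in_KL[OF assms(2,3,4,7,8,9)] power_score_transforms_to_Holder[OF assms(3) _ assms(4,7,8,9)] by blast

end
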